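(* Each $\aleph_0$-space is $QC$-Maslyuchenko.
   Context: A family $\mathcal N$ of subsets of a topological space $X$ is a $k$-network if for any compact $K\subset X$ and any neighborhood $O_K\subset X$ of $K$ there is a finite subfamily $\mathcal F\subset\mathcal N$ with $K\subset\bigcup\mathcal F\subset O_K$. An $\aleph_0$-space is a regular (Hausdorff) space with a countable $k$-network. $D(f)$ denotes the set of discontinuity points of a function $f$. A subset of a topological space $X$ is meager if it is a countable union of nowhere dense subsets of $X$. A function $f:X\times Y\to Z$ is a $QC$-function if (i) for every $(x,y)\in X\times Y$ and open sets $O_x\subset X$, $O_y\subset Y$, $O\subset Z$ with $(x,y)\in O_x\times O_y$ and $f(x,y)\in O$ there is a non-empty open set $W\subset O_x$ such that $f(\{w\}\times O_y)\cap O\neq\emptyset$ for every $w\in W$; and (ii) for every $x\in X$ the function $Y\to Z$, $y\mapsto f(x,y)$, is continuous. A topological space $Z$ is $QC$-Maslyuchenko if for every topological space $X$, every second-countable space $Y$ and every $QC$-function $f:X\times Y\to Z$ the projection of $D(f)\subset X\times Y$ on $X$ is meager in $X$. *)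

theory Defs
  imports "HOL-Analysis.Analysis"
begin

definition neighborhood_of_set :: "'a topology \<Rightarrow> 'a set \<Rightarrow> 'a set \<Rightarrow> bool" where
  "neighborhood_of_set X K N \<longleftrightarrow>
     N \<subseteq> topspace X \<and> (\<exists>U. openin X U \<and> K \<subseteq> U \<and> U \<subseteq> N)"

definition k_network :: "'a topology \<Rightarrow> 'a set set \<Rightarrow> bool" where
  "k_network X \<N> \<longleftrightarrow>
     (\<forall>N\<in>\<N>. N \<subseteq> topspace X) \<and>
     (\<forall>K U. compactin X K \<and> neighborhood_of_set X K U \<longrightarrow>
        (\<exists>\<F>. finite \<F> \<and> \<F> \<subseteq> \<N> \<and> K \<subseteq> \<Union>\<F> \<and> \<Union>\<F> \<subseteq> U))"

definition aleph0_space :: "'a topology \<Rightarrow> bool" where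
  "aleph0_space X \<longleftrightarrow>
     regular_space X \<and> Hausdorff_space X \<and> (\<exists>\<N>. countable \<N> \<and> k_network X \<N>)"

definition discontinuity_points :: "'a topology \<Rightarrow> 'b topology \<Rightarrow> ('a \<Rightarrow> 'b) \<Rightarrow> 'a set" where
  "discontinuity_points X Y f = {x \<in> topspace X. \<not> topcontinuous_at X Y f x}"

definition nowhere_dense_in :: "'a topology \<Rightarrow> 'a set \<Rightarrow> bool" where
  "nowhere_dense_in X A \<longleftrightarrow> A \<subseteq> topspace X \<and> X interior_of (X closure_of A) = {}"

definition meager_in :: "'a topology \<Rightarrow> 'a set \<Rightarrow> bool" where
  "meager_in X A \<longleftrightarrow>
     (\<exists>\<A>. countable \<A> \<and> (\<forall>B\<in>\<A>. nowhere_dense_in X B) \<and> A = \<Union>\<A>)"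

definition QC_function ::
    "'x topology \<Rightarrow> 'y topology \<Rightarrow> 'z topology \<Rightarrow> ('x \<times> 'y \<Rightarrow> 'z) \<Rightarrow> bool" where
  "QC_function X Y Z f \<longleftrightarrow>
     f \<in> topspace X \<times> topspace Y \<rightarrow> topspace Z \<and>
     (\<forall>x\<in>topspace X. \<forall>y\<in>topspace Y. \<forall>Ox Oy Oz.
        openin X Ox \<and> openin Y Oy \<and> openin Z Oz \<and>
        (x, y) \<in> Ox \<times> Oy \<and> f (x, y) \<in> Oz \<longrightarrow>
        (\<exists>W. openin X W \<and> W \<noteq> {} \<and> W \<subseteq> Ox \<and>
             (\<forall>w\<in>W. f ` ({w} \<times> Oy) \<inter> Oz \<noteq> {}))) \<and>
     (\<forall>x\<in>topspace X. continuous_map Y Z (\<lambda>y. f (x, y)))"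

(* The class of all spaces X and Y cannot be quantified over inside a definition. The
   underlying types of X and Y are therefore type parameters, and the full property of Z is
   QC_Maslyuchenko TYPE('x) TYPE('y) Z with 'x and 'y left as arbitrary type variables. *)
definition QC_Maslyuchenko :: "'x itself \<Rightarrow> 'y itself \<Rightarrow> 'z topology \<Rightarrow> bool" where
  "QC_Maslyuchenko _ _ Z \<longleftrightarrow>
     (\<forall>(X :: 'x topology) (Y :: 'y topology) f.
        second_countable Y \<and> QC_function X Y Z f \<longrightarrow>
        meager_in X (fst ` discontinuity_points (prod_topology X Y) Z f))"

end

theory Submission
  imports Defs
begin

text \<open>
  Let \<open>f : X \<times> Y \<rightarrow> Z\<close> be a \<open>QC\<close>-function, let \<open>\<N>\<close> be a countable \<open>k\<close>-network of \<open>Z\<close> and let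
  \<open>\<B>\<close> be a countable base of \<open>Y\<close>. For a closed set \<open>C\<close> of \<open>Z\<close> and an open set \<open>B\<close> of \<open>Y\<close>, let \<open>A(C, B)\<close>
  be the set of all \<open>x\<close> whose section \<open>f(x, _)\<close> maps \<open>B\<close> into \<open>C\<close>. The proof combines two facts.

  \<^item> Quasicontinuity in the first variable makes \<open>A(C, B)\<close> almost open: the interior \<open>U\<close> of its
    closure is contained in \<open>A(C, B)\<close>, so that \<open>f\<close> maps all of \<open>U \<times> B\<close> into \<open>C\<close>
    (\<open>interior_closure_into_set_subset\<close>). The remainder \<open>A(C, B) - U\<close> is nowhere dense.

  \<^item> Along a convergent sequence a \<open>k\<close>-network behaves like a network, because a convergent sequence
    together with its limit is compact. As \<open>Y\<close> is first countable, every continuous section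
    \<open>f(x, _)\<close> therefore maps a whole neighborhood of \<open>y\<close> into a finite union of members of \<open>\<N>\<close>
    lying in a prescribed neighborhood of \<open>f(x, y)\<close> (\<open>k_network_captures_neighborhood\<close>).

  Now let \<open>f\<close> be discontinuous at \<open>(x, y)\<close>, as witnessed by an open set \<open>G\<close>. Regularity of \<open>Z\<close> and
  the second fact give a basic \<open>B\<close> containing \<open>y\<close> and the closure \<open>C\<close> of a finite union of members
  of \<open>\<N>\<close> with \<open>x \<in> A(C, B)\<close> and \<open>C \<subseteq> G\<close>. If \<open>x\<close> belonged to the open set \<open>U\<close> of the first fact, then
  \<open>U \<times> B\<close> would be a neighborhood of \<open>(x, y)\<close> mapped into \<open>G\<close>. Hence \<open>x\<close> lies in the nowhere
  dense remainder, and there are only countably many pairs \<open>(C, B)\<close>.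
\<close>

section \<open>Nowhere dense and meager sets\<close>

lemma nowhere_dense_in_subset:
  assumes "nowhere_dense_in X A" "B \<subseteq> A"
  shows "nowhere_dense_in X B"
  using assms interior_of_mono[OF closure_of_mono[OF assms(2)], of X X]
  unfolding nowhere_dense_in_def by blast

lemma nowhere_dense_in_Diff_interior_closure:
  assumes "A \<subseteq> topspace X"
  shows "nowhere_dense_in X (A - X interior_of (X closure_of A))"
proof -
  let ?I = "X interior_of (X closure_of A)"
  have "X closure_of (A - ?I) \<subseteq> X closure_of A - ?I"
    by (rule closure_of_minimal)
      (use closure_of_subset[OF assms] in \<open>auto simp: closedin_diff\<close>)
  then have "X interior_of (X closure_of (A - ?I)) \<subseteq> X closure_of A - ?I"
    by (rule order_trans[OF interior_of_subset])
  moreover have "X interior_of (X closure_of (A - ?I)) \<subseteq> ?I"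
    by (intro interior_of_mono closure_of_mono Diff_subset)
  ultimately have "X interior_of (X closure_of (A - ?I)) = {}"
    by blast
  moreover have "A - ?I \<subseteq> topspace X"
    using assms by blast
  ultimately show ?thesis
    unfolding nowhere_dense_in_def by simp
qed

lemma meager_in_subset_UN:
  assumes "countable I" "\<And>i. i \<in> I \<Longrightarrow> nowhere_dense_in X (A i)" "S \<subseteq> (\<Union>i\<in>I. A i)"
  shows "meager_in X S"
  unfolding meager_in_def
proof (intro exI conjI ballI)
  show "countable ((\<lambda>i. S \<inter> A i) ` I)"
    using assms(1) by simp
  show "nowhere_dense_in X B" if "B \<in> (\<lambda>i. S \<inter> A i) ` I" for B
    using that assms(2) by (auto intro: nowhere_dense_in_subset)
  show "S = \<Union>((\<lambda>i. S \<inter> A i) ` I)"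
    using assms(3) by blast
qed

section \<open>Networks and continuous images of first-countable spaces\<close>

lemma decreasing_neighborhood_base:
  assumes "first_countable Y" "y \<in> topspace Y"
  obtains U :: "nat \<Rightarrow> 'a set"
  where "\<And>n. openin Y (U n)" "\<And>n. y \<in> U n"
    "\<And>G. openin Y G \<Longrightarrow> y \<in> G \<Longrightarrow> \<exists>n. \<forall>m\<ge>n. U m \<subseteq> G"
proof -
  obtain \<B> where \<B>: "countable \<B>" "\<And>V. V \<in> \<B> \<Longrightarrow> openin Y V"
    "\<And>G. openin Y G \<Longrightarrow> y \<in> G \<Longrightarrow> \<exists>V\<in>\<B>. y \<in> V \<and> V \<subseteq> G"
    using assms unfolding first_countable_def by metis
  define \<C> where "\<C> = {V \<in> \<B>. y \<in> V}"
  have \<C>: "countable \<C>" "\<C> \<noteq> {}"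
    using \<B>(1) \<B>(3)[OF openin_topspace assms(2)] by (auto simp: \<C>_def)
  define U where "U n = (\<Inter>i\<le>n. from_nat_into \<C> i)" for n
  have in_\<C>: "from_nat_into \<C> i \<in> \<C>" for i
    using \<C>(2) by (rule from_nat_into)
  show thesis
  proof
    show "openin Y (U n)" "y \<in> U n" for n
      using in_\<C> \<B>(2) by (auto simp: U_def \<C>_def intro!: openin_INT2)
    show "\<exists>n. \<forall>m\<ge>n. U m \<subseteq> G" if "openin Y G" "y \<in> G" for G
    proof -
      obtain V where "V \<in> \<C>" "V \<subseteq> G"
        using \<B>(3) \<open>openin Y G\<close> \<open>y \<in> G\<close> by (auto simp: \<C>_def)
      moreover obtain n where "from_nat_into \<C> n = V"
        using from_nat_into_surj[OF \<C>(1) \<open>V \<in> \<C>\<close>] by metis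
      moreover have "U m \<subseteq> from_nat_into \<C> n" if "m \<ge> n" for m
        using that by (auto simp: U_def)
      ultimately show ?thesis
        by (metis order_trans)
    qed
  qed
qed

text \<open>
  Otherwise, using a decreasing neighborhood base at \<open>y\<close> and an enumeration of the network, one picks
  points \<open>s n\<close> converging to \<open>y\<close> such that \<open>g (s n)\<close> avoids the first \<open>n\<close> members contained in \<open>V\<close>.
  The points \<open>g (s n)\<close> and their limit \<open>g y\<close> form a compact subset of \<open>V\<close>, which finitely many
  members contained in \<open>V\<close> must cover; these occur among the first \<open>m\<close> members for some \<open>m\<close>, and
  \<open>g (s m)\<close> is not covered.
\<close>
lemma k_network_captures_neighborhood:
  assumes "first_countable Y" "countable \<N>" "k_network Z \<N>"
    and g: "continuous_map Y Z g" and y: "y \<in> topspace Y"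
    and V: "openin Z V" "g y \<in> V"
  obtains U \<F> where "openin Y U" "y \<in> U" "finite \<F>" "\<F> \<subseteq> \<N>" "g ` U \<subseteq> \<Union>\<F>" "\<Union>\<F> \<subseteq> V"
proof (rule ccontr)
  assume no_capture: "\<not> thesis"
  note capture = that
  have miss: "\<exists>u\<in>U. g u \<notin> \<Union>\<F>"
    if "openin Y U" "y \<in> U" "finite \<F>" "\<F> \<subseteq> \<N>" "\<Union>\<F> \<subseteq> V" for U \<F>
  proof (rule ccontr)
    assume "\<not> (\<exists>u\<in>U. g u \<notin> \<Union>\<F>)"
    then have "g ` U \<subseteq> \<Union>\<F>"
      by blast
    then show False
      using no_capture capture[OF that(1-4) _ that(5)] by simp
  qed
  obtain B :: "nat \<Rightarrow> 'a set" where B: "\<And>n. openin Y (B n)" "\<And>n. y \<in> B n"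
    "\<And>G. openin Y G \<Longrightarrow> y \<in> G \<Longrightarrow> \<exists>n. \<forall>m\<ge>n. B m \<subseteq> G"
    using decreasing_neighborhood_base[OF assms(1) y] by metis
  define P where "P = {u \<in> topspace Y. g u \<in> V}"
  have P: "openin Y P" "y \<in> P"
    using g V y by (auto simp: P_def openin_continuous_map_preimage)
  \<comment> \<open>Intersecting with \<open>\<N>\<close> only matters when \<open>\<N>\<close> is empty and the enumeration is a default value.\<close>
  define \<M> where "\<M> n = {N \<in> from_nat_into \<N> ` {..n} \<inter> \<N>. N \<subseteq> V}" for n
  have "\<exists>u \<in> B n \<inter> P. g u \<notin> \<Union>(\<M> n)" for n
    using B(1,2) P by (intro miss) (auto simp: \<M>_def)
  then obtain s where s: "\<And>n. s n \<in> B n" "\<And>n. s n \<in> P" "\<And>n. g (s n) \<notin> \<Union>(\<M> n)"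
    by (metis IntD1 IntD2)
  have "limitin Y s y sequentially"
    unfolding limitin_sequentially using y B(3) s(1) by (meson subsetD)
  then have "limitin Z (g \<circ> s) (g y) sequentially"
    by (rule continuous_map_limit[OF g])
  moreover have in_V: "range (g \<circ> s) \<subseteq> V"
    using s(2) by (auto simp: P_def)
  ultimately have "compactin Z (insert (g y) (range (g \<circ> s)))"
    using openin_subset[OF V(1)] by (intro compactin_sequence_with_limit) auto
  moreover have "neighborhood_of_set Z (insert (g y) (range (g \<circ> s))) V"
    using in_V V openin_subset[OF V(1)] unfolding neighborhood_of_set_def by blast
  ultimately obtain \<F> where \<F>: "finite \<F>" "\<F> \<subseteq> \<N>"
    "insert (g y) (range (g \<circ> s)) \<subseteq> \<Union>\<F>" "\<Union>\<F> \<subseteq> V"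
    using assms(3) unfolding k_network_def by metis
  obtain m where m: "to_nat_on \<N> ` \<F> \<subseteq> {..m}"
    using \<F>(1) by (meson finite_imageI finite_nat_iff_bounded_le)
  have "\<F> \<subseteq> \<M> m"
  proof
    fix N assume N: "N \<in> \<F>"
    then have "from_nat_into \<N> (to_nat_on \<N> N) = N"
      using \<F>(2) assms(2) by (simp add: subsetD)
    then have "N \<in> from_nat_into \<N> ` {..m}"
      using m N by (metis image_eqI image_subset_iff)
    then show "N \<in> \<M> m"
      using N \<F>(2,4) by (auto simp: \<M>_def)
  qed
  then have "g (s m) \<notin> \<Union>\<F>"
    using s(3) by (meson Union_mono subsetD)
  moreover have "g (s m) \<in> range (g \<circ> s)"
    by simp
  ultimately show False
    using \<F>(3) by (meson insert_subset subsetD)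
qed

section \<open>Discontinuity points of QC-functions\<close>

text \<open>
  A point \<open>w\<close> of the interior \<open>I\<close> with \<open>f (w, b) \<notin> C\<close> for some \<open>b \<in> B\<close> would, by
  quasicontinuity, yield a nonempty open part of \<open>I\<close> all of whose sections leave \<open>C\<close> on \<open>B\<close>. Being
  contained in the closure of the displayed set, this part has to meet that set.
\<close>
lemma interior_closure_into_set_subset:
  fixes f :: "'x \<times> 'y \<Rightarrow> 'z"
  assumes QC: "QC_function X Y Z f" and "openin Y B" "closedin Z C"
  defines "A \<equiv> {x \<in> topspace X. f ` ({x} \<times> B) \<subseteq> C}"
  shows "X interior_of (X closure_of A) \<subseteq> A"
proof
  let ?I = "X interior_of (X closure_of A)"
  fix w assume w: "w \<in> ?I"
  then have wX: "w \<in> topspace X"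
    using interior_of_subset_topspace by fastforce
  have "f (w, b) \<in> C" if b: "b \<in> B" for b
  proof (rule ccontr)
    assume nC: "f (w, b) \<notin> C"
    have bY: "b \<in> topspace Y"
      using b openin_subset[OF \<open>openin Y B\<close>] by blast
    have "f (w, b) \<in> topspace Z - C"
      using QC wX bY nC unfolding QC_function_def by (auto simp: Pi_iff)
    moreover have "openin Z (topspace Z - C)"
      using \<open>closedin Z C\<close> by blast
    ultimately obtain W where W: "openin X W" "W \<noteq> {}" "W \<subseteq> ?I"
      "\<forall>v\<in>W. f ` ({v} \<times> B) \<inter> (topspace Z - C) \<noteq> {}"
      using QC wX bY w b \<open>openin Y B\<close> openin_interior_of[of X "X closure_of A"]
      unfolding QC_function_def by (metis mem_Sigma_iff)
    have "W \<inter> A = {}"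
      using W(4) by (auto simp: A_def)
    then have "W \<inter> X closure_of A = {}"
      using openin_Int_closure_of_eq_empty[OF W(1)] by blast
    moreover have "W \<subseteq> X closure_of A"
      using W(3) interior_of_subset by (rule order_trans)
    ultimately show False
      using W(2) by blast
  qed
  then show "w \<in> A"
    using wX by (auto simp: A_def)
qed

lemma QC_function_meager_discontinuities:
  fixes f :: "'x \<times> 'y \<Rightarrow> 'z"
  assumes reg: "regular_space Z" and \<N>: "countable \<N>" "k_network Z \<N>"
    and Y: "second_countable Y" and QC: "QC_function X Y Z f"
  shows "meager_in X (fst ` discontinuity_points (prod_topology X Y) Z f)"
proof -
  obtain \<B> where \<B>: "countable \<B>" "\<And>V. V \<in> \<B> \<Longrightarrow> openin Y V"
    "\<And>U y. openin Y U \<Longrightarrow> y \<in> U \<Longrightarrow> \<exists>V\<in>\<B>. y \<in> V \<and> V \<subseteq> U"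
    using Y unfolding second_countable_def by metis
  have f: "f \<in> topspace X \<times> topspace Y \<rightarrow> topspace Z"
    and section_cont: "\<And>x. x \<in> topspace X \<Longrightarrow> continuous_map Y Z (\<lambda>y. f (x, y))"
    using QC unfolding QC_function_def by auto
  define A where "A C B = {x \<in> topspace X. f ` ({x} \<times> B) \<subseteq> C}" for C B
  define R where "R = (\<lambda>(\<F>, B). let S = A (Z closure_of \<Union>\<F>) B in S - X interior_of (X closure_of S))"
  define I where "I = {\<F>. finite \<F> \<and> \<F> \<subseteq> \<N>} \<times> \<B>"
  show ?thesis
  proof (rule meager_in_subset_UN)
    show "countable I"
      using \<N>(1) \<B>(1) unfolding I_def by (intro countable_SIGMA countable_Collect_finite_subset)
    show "nowhere_dense_in X (R i)" for i
      unfolding R_def Let_def case_prod_beta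
      by (rule nowhere_dense_in_Diff_interior_closure) (auto simp: A_def)
    show "fst ` discontinuity_points (prod_topology X Y) Z f \<subseteq> (\<Union>i\<in>I. R i)"
    proof clarify
      fix x y assume D: "(x, y) \<in> discontinuity_points (prod_topology X Y) Z f"
      then have xy: "x \<in> topspace X" "y \<in> topspace Y"
        by (auto simp: discontinuity_points_def)
      obtain G where G: "openin Z G" "f (x, y) \<in> G"
        and not_into: "\<And>U. openin (prod_topology X Y) U \<Longrightarrow> (x, y) \<in> U \<Longrightarrow> \<not> f ` U \<subseteq> G"
        using D f unfolding discontinuity_points_def topcontinuous_at_def
        by (auto simp: image_subset_iff)
      obtain V C where V: "openin Z V" "f (x, y) \<in> V" and C: "closedin Z C" "V \<subseteq> C" "C \<subseteq> G"
        using reg G unfolding neighbourhood_base_of_closedin[symmetric] neighbourhood_base_of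
        by meson
      obtain U \<F> where U: "openin Y U" "y \<in> U" and \<F>: "finite \<F>" "\<F> \<subseteq> \<N>"
        and into: "(\<lambda>y. f (x, y)) ` U \<subseteq> \<Union>\<F>" and "\<Union>\<F> \<subseteq> V"
        by (rule k_network_captures_neighborhood[OF second_countable_imp_first_countable[OF Y]
              \<N> section_cont[OF xy(1)] xy(2) V])
      obtain B where B: "B \<in> \<B>" "y \<in> B" "B \<subseteq> U"
        using \<B>(3) U by blast
      let ?C = "Z closure_of \<Union>\<F>"
      let ?I = "X interior_of (X closure_of A ?C B)"
      have sub_O: "?C \<subseteq> G"
        using C \<open>\<Union>\<F> \<subseteq> V\<close> by (meson closure_of_minimal order_trans)
      have "\<Union>\<F> \<subseteq> ?C"
        using \<open>\<Union>\<F> \<subseteq> V\<close> openin_subset[OF V(1)] by (intro closure_of_subset) blast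
      then have "f (x, b) \<in> ?C" if "b \<in> B" for b
        using into B(3) that by (meson image_subset_iff subsetD)
      then have "x \<in> A ?C B"
        using xy(1) by (auto simp: A_def)
      moreover have "x \<notin> ?I"
      proof
        assume "x \<in> ?I"
        moreover have "?I \<subseteq> A ?C B"
          unfolding A_def by (rule interior_closure_into_set_subset[OF QC \<B>(2)[OF B(1)]]) simp
        then have "f ` (?I \<times> B) \<subseteq> G"
          using sub_O by (auto simp: A_def)
        ultimately show False
          using not_into[of "?I \<times> B"] B(2) \<B>(2)[OF B(1)] by (simp add: openin_prod_Times_iff)
      qed
      ultimately have "x \<in> R (\<F>, B)"
        by (simp add: R_def Let_def)
      then show "fst (x, y) \<in> (\<Union>i\<in>I. R i)"
        using \<F> B(1) by (auto simp: I_def)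
    qed
  qed
qed

theorem corollary3p10:
  fixes Z :: "'z topology"
  assumes "aleph0_space Z"
  shows "QC_Maslyuchenko TYPE('x) TYPE('y) Z"
proof -
  obtain \<N> where "countable \<N>" "k_network Z \<N>"
    using assms unfolding aleph0_space_def by metis
  moreover have "regular_space Z"
    using assms unfolding aleph0_space_def by simp
  ultimately show ?thesis
    unfolding QC_Maslyuchenko_def by (simp add: QC_function_meager_discontinuities)
qed

end
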